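(* Let $G$ be a connected graph on $n\ge 2$ vertices with edge-connectivity $k$. Then $$b(G)\le \frac{nk}{2(n-1)}.$$
   Context: Graphs are finite, simple, undirected and unweighted. For a graph $G$ with vertex set $V(G)$, $|V(G)|=n\ge 2$, and edge set $E(G)$, the $\ell_1$-Fiedler value is $$b(G)=\min\Big\{\sum_{uv\in E(G)}|x_u-x_v| : x\in\mathbb{R}^{V(G)},\ \sum_{v\in V(G)}x_v=0,\ \sum_{v\in V(G)}|x_v|=1\Big\}.$$ The edge-connectivity of $G$ is the minimum number of edges whose removal disconnects $G$. *)

theory Defs
  imports "HOL-Analysis.Analysis"
begin

definition simple_graph :: "'a set \<Rightarrow> 'a set set \<Rightarrow> bool" where
  "simple_graph V E \<longleftrightarrow> finite V \<and> (\<forall>e\<in>E. \<exists>u\<in>V. \<exists>v\<in>V. u \<noteq> v \<and> e = {u, v})"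

definition graph_connected :: "'a set \<Rightarrow> 'a set set \<Rightarrow> bool" where
  "graph_connected V E \<longleftrightarrow>
     V \<noteq> {} \<and> (\<forall>u\<in>V. \<forall>v\<in>V. (u, v) \<in> {(a, b). {a, b} \<in> E}\<^sup>*)"

(* On a graph with one vertex no edge set is disconnecting and LEAST is unspecified;
   lemma edge_connectivity_attained shows that it is a genuine minimum
   on graphs with at least two vertices. *)
definition edge_connectivity :: "'a set \<Rightarrow> 'a set set \<Rightarrow> nat" where
  "edge_connectivity V E =
     (LEAST m. \<exists>F. F \<subseteq> E \<and> card F = m \<and> \<not> graph_connected V (E - F))"

(* |x_u - x_v| for e = {u, v}; it does not depend on the order of the endpoints,
   see lemma edge_variation_doubleton. *)
definition edge_variation :: "('a \<Rightarrow> real) \<Rightarrow> 'a set \<Rightarrow> real" where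
  "edge_variation x e = (THE d. \<exists>u v. e = {u, v} \<and> d = \<bar>x u - x v\<bar>)"

definition total_variation :: "'a set set \<Rightarrow> ('a \<Rightarrow> real) \<Rightarrow> real" where
  "total_variation E x = (\<Sum>e\<in>E. edge_variation x e)"

(* Values of x outside V are irrelevant, so total functions stand for vectors indexed by V. *)
definition l1_feasible :: "'a set \<Rightarrow> ('a \<Rightarrow> real) set" where
  "l1_feasible V = {x. (\<Sum>v\<in>V. x v) = 0 \<and> (\<Sum>v\<in>V. \<bar>x v\<bar>) = 1}"

(* The infimum is a minimum, see lemma l1_fiedler_attained. *)
definition l1_fiedler :: "'a set \<Rightarrow> 'a set set \<Rightarrow> real" where
  "l1_fiedler V E = (INF x\<in>l1_feasible V. total_variation E x)"

lemma edge_variation_doubleton: "edge_variation x {u, v} = \<bar>x u - x v\<bar>"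
  unfolding edge_variation_def
proof (rule the_equality)
  show "\<exists>a b. {u, v} = {a, b} \<and> \<bar>x u - x v\<bar> = \<bar>x a - x b\<bar>" by blast
next
  fix d assume "\<exists>a b. {u, v} = {a, b} \<and> d = \<bar>x a - x b\<bar>"
  then show "d = \<bar>x u - x v\<bar>"
    by (auto simp: doubleton_eq_iff abs_minus_commute)
qed

lemma edge_connectivity_attained:
  assumes "simple_graph V E" "2 \<le> card V"
  shows "\<exists>F. F \<subseteq> E \<and> card F = edge_connectivity V E \<and> \<not> graph_connected V (E - F)"
    and "\<And>F. F \<subseteq> E \<Longrightarrow> \<not> graph_connected V (E - F) \<Longrightarrow> edge_connectivity V E \<le> card F"
proof -
  obtain u v where "u \<in> V" "v \<in> V" "u \<noteq> v"
    using assms(2) by (metis card_le_Suc0_iff_eq card.infinite not_less_eq_eq numeral_2_eq_2 zero_le)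
  then have "\<not> graph_connected V (E - E)"
    by (auto simp: graph_connected_def)
  then have "\<exists>m F. F \<subseteq> E \<and> card F = m \<and> \<not> graph_connected V (E - F)"
    by blast
  then show "\<exists>F. F \<subseteq> E \<and> card F = edge_connectivity V E \<and> \<not> graph_connected V (E - F)"
    unfolding edge_connectivity_def by (rule LeastI_ex)
  show "edge_connectivity V E \<le> card F"
    if "F \<subseteq> E" "\<not> graph_connected V (E - F)" for F
    unfolding edge_connectivity_def using that by (intro Least_le) blast
qed

lemma l1_fiedler_attained:
  assumes G: "simple_graph V E" and n: "2 \<le> card V"
  shows "\<exists>x\<in>l1_feasible V. total_variation E x = l1_fiedler V E"
    and "\<And>y. y \<in> l1_feasible V \<Longrightarrow> l1_fiedler V E \<le> total_variation E y"
proof -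
  have fin: "finite V" and E: "\<And>e. e \<in> E \<Longrightarrow> \<exists>u\<in>V. \<exists>v\<in>V. e = {u, v}"
    using G unfolding simple_graph_def by blast+
  obtain a b where ab: "a \<in> V" "b \<in> V" "a \<noteq> b"
    using n by (metis card_le_Suc0_iff_eq card.infinite not_less_eq_eq numeral_2_eq_2 zero_le)
  define P where "P = (\<Pi>\<^sub>E v\<in>UNIV. if v \<in> V then {-1..1::real} else {0})"
  define K where "K = l1_feasible V \<inter> P"
  have "compactin (product_topology (\<lambda>_. euclidean) UNIV) P"
    unfolding P_def by (subst compactin_PiE) (auto simp: PiE_eq_empty_iff)
  then have P: "compact P"
    by (simp add: euclidean_product_topology)
  have "closed (l1_feasible V)"
    unfolding l1_feasible_def
    by (intro closed_Collect_conj closed_Collect_eq continuous_intros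
        continuous_on_product_coordinates)
  then have "compact K"
    unfolding K_def using P by (rule closed_Int_compact)
  define z where "z = (\<lambda>v. (if v = a then 1/2 else 0) + (if v = b then - (1/2) else 0 :: real))"
  have absz: "\<bar>z v\<bar> = (if v = a then 1/2 else 0) + (if v = b then 1/2 else 0)" for v
    using ab by (auto simp: z_def)
  have "z \<in> l1_feasible V"
    unfolding l1_feasible_def using ab fin
    by (simp add: absz sum.distrib) (simp add: z_def sum.distrib)
  moreover have "z \<in> P"
    using ab by (auto simp: P_def z_def)
  ultimately have "K \<noteq> {}"
    by (auto simp: K_def)
  have "continuous_on K (\<lambda>x. edge_variation x e)" if eE: "e \<in> E" for e
  proof -
    obtain u v where e: "e = {u, v}" using E[OF eE] by blast
    show ?thesis unfolding e edge_variation_doubleton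
      by (intro continuous_intros continuous_on_product_coordinates
          continuous_on_subset[OF continuous_on_product_coordinates]) auto
  qed
  then have "continuous_on K (total_variation E)"
    unfolding total_variation_def by (intro continuous_on_sum)
  then obtain x where x: "x \<in> K" "\<And>y. y \<in> K \<Longrightarrow> total_variation E x \<le> total_variation E y"
    using continuous_attains_inf[OF \<open>compact K\<close> \<open>K \<noteq> {}\<close>] by blast
  have le: "total_variation E x \<le> total_variation E y" if y: "y \<in> l1_feasible V" for y
  proof -
    define w where "w = (\<lambda>v. if v \<in> V then y v else 0)"
    have w: "w \<in> l1_feasible V"
      using y by (simp add: l1_feasible_def w_def)
    have "\<bar>y v\<bar> \<le> 1" if "v \<in> V" for v
      using member_le_sum[of v V "\<lambda>v. \<bar>y v\<bar>"] that fin y by (auto simp: l1_feasible_def)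
    then have "w \<in> P"
      by (auto simp: P_def w_def abs_le_iff minus_le_iff)
    have "total_variation E w = total_variation E y"
      unfolding total_variation_def
    proof (rule sum.cong[OF refl])
      fix e assume "e \<in> E"
      then obtain p q where "p \<in> V" "q \<in> V" "e = {p, q}" using E by blast
      then show "edge_variation w e = edge_variation y e"
        by (simp add: edge_variation_doubleton w_def)
    qed
    then show ?thesis using x(2)[of w] w \<open>w \<in> P\<close> by (simp add: K_def)
  qed
  have xf: "x \<in> l1_feasible V" using x(1) by (simp add: K_def)
  have eq: "l1_fiedler V E = total_variation E x"
    unfolding l1_fiedler_def using xf le by (intro cInf_eq_minimum) auto
  show "\<exists>x\<in>l1_feasible V. total_variation E x = l1_fiedler V E"
    using eq xf by auto
  show "l1_fiedler V E \<le> total_variation E y" if "y \<in> l1_feasible V" for y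
    using eq le that by simp
qed

end

theory Submission
  imports Defs
begin

text \<open>
  For a nonempty proper vertex set \<open>S\<close> of size \<open>s\<close>, the vector that is \<open>1 / (2 s)\<close> on \<open>S\<close> and
  \<open>- 1 / (2 (n - s))\<close> elsewhere is feasible, and only edges leaving \<open>S\<close> contribute to its total
  variation, each by \<open>n / (2 s (n - s))\<close>. A minimum edge cut separates such an \<open>S\<close> from the rest
  with at most \<open>k\<close> edges, and \<open>s (n - s) \<ge> n - 1\<close>.
\<close>

text \<open>The edge cut between \<open>S\<close> and its complement, phrased through the edge as a
  set so that no endpoint has to be singled out.\<close>

definition edge_boundary :: "'a set set \<Rightarrow> 'a set \<Rightarrow> 'a set set" where
  "edge_boundary E S = {e \<in> E. e \<inter> S \<noteq> {} \<and> \<not> e \<subseteq> S}"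

lemma simple_graph_finite_edges:
  assumes "simple_graph V E"
  shows "finite E"
proof (rule finite_subset)
  show "E \<subseteq> Pow V"
    using assms by (fastforce simp: simple_graph_def)
  show "finite (Pow V)"
    using assms by (simp add: simple_graph_def)
qed

lemma l1_fiedler_le_edge_boundary:
  assumes G: "simple_graph V E" and S: "S \<subset> V" "S \<noteq> {}"
  shows "l1_fiedler V E \<le>
    real (card V) * real (card (edge_boundary E S)) / (2 * (real (card S) * real (card (V - S))))"
proof -
  have fin: "finite V" using G by (simp add: simple_graph_def)
  then have finS: "finite S" "finite (V - S)" using S finite_subset by auto
  define s t where "s = real (card S)" and "t = real (card (V - S))"
  have pos: "s > 0" "t > 0"
    using S finS by (auto simp: s_def t_def card_gt_0_iff)
  have st: "real (card V) = s + t"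
    using card_Un_disjoint[OF finS] S by (simp add: s_def t_def Un_absorb1 psubset_imp_subset)
  have split: "(\<Sum>v\<in>V. f v) = (\<Sum>v\<in>S. f v) + (\<Sum>v\<in>V - S. f v)" for f :: "'a \<Rightarrow> real"
    using sum.subset_diff[of S V f] S fin by simp
  \<comment> \<open>Each side carries absolute mass 1/2, with opposite signs; this gives sum 0 and
    l1-norm 1.\<close>
  define x where "x v = (if v \<in> S then 1 / (2 * s) else - 1 / (2 * t))" for v
  have "(\<Sum>v\<in>V. x v) = s * (1 / (2 * s)) + t * (- 1 / (2 * t))"
    unfolding split by (simp add: x_def s_def t_def)
  moreover have "(\<Sum>v\<in>V. \<bar>x v\<bar>) = s * (1 / (2 * s)) + t * (1 / (2 * t))"
    unfolding split using pos by (simp add: x_def s_def t_def)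
  ultimately have x: "x \<in> l1_feasible V"
    using pos by (simp add: l1_feasible_def)
  have c: "1 / (2 * s) + 1 / (2 * t) = (s + t) / (2 * (s * t))"
    using pos by (simp add: field_simps)
  have inv_pos: "1 / (2 * s) > 0" "1 / (2 * t) > 0"
    using pos by simp_all
  have "edge_variation x e = (if e \<in> edge_boundary E S then (s + t) / (2 * (s * t)) else 0)"
    if "e \<in> E" for e
  proof -
    obtain u v where "e = {u, v}"
      using G \<open>e \<in> E\<close> unfolding simple_graph_def by blast
    \<comment> \<open>Either endpoint of a crossing edge may be the one in \<open>S\<close>, so the
      jump is computed in both orders.\<close>
    moreover have "\<bar>1 / (2 * s) - - 1 / (2 * t)\<bar> = (s + t) / (2 * (s * t))"
        "\<bar>- 1 / (2 * t) - 1 / (2 * s)\<bar> = (s + t) / (2 * (s * t))"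
      using c inv_pos by linarith+
    ultimately show ?thesis
      using \<open>e \<in> E\<close> by (auto simp: edge_variation_doubleton edge_boundary_def x_def)
  qed
  then have "total_variation E x = (\<Sum>e\<in>E. if e \<in> edge_boundary E S then (s + t) / (2 * (s * t)) else 0)"
    unfolding total_variation_def by (rule sum.cong[OF refl])
  also have "\<dots> = (\<Sum>e\<in>edge_boundary E S. (s + t) / (2 * (s * t)))"
    using simple_graph_finite_edges[OF G]
    by (intro sum.mono_neutral_cong_right) (auto simp: edge_boundary_def)
  also have "\<dots> = real (card V) * real (card (edge_boundary E S)) / (2 * (s * t))"
    by (simp add: st)
  finally have tv: "total_variation E x = \<dots>" .
  have "card V \<ge> 2"
  proof -
    have "card S > 0" "card (V - S) > 0" using pos by (auto simp: s_def t_def)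
    then show ?thesis using st unfolding s_def t_def by linarith
  qed
  from l1_fiedler_attained(2)[OF G this x] show ?thesis
    unfolding tv s_def t_def .
qed

text \<open>Take for \<open>S\<close> the vertices still reachable from some \<open>u\<close> after
  deleting \<open>F\<close>, where \<open>u\<close> fails to reach some vertex. An edge leaving
  \<open>S\<close> that survived the deletion would enlarge \<open>S\<close>.\<close>

lemma disconnecting_set_contains_edge_boundary:
  assumes G: "simple_graph V E" and V: "V \<noteq> {}" and F: "\<not> graph_connected V (E - F)"
  obtains S where "S \<subset> V" "S \<noteq> {}" "edge_boundary E S \<subseteq> F"
proof -
  let ?R = "{(a, b). {a, b} \<in> E - F}\<^sup>*"
  \<comment> \<open>As \<open>V\<close> is nonempty, disconnectedness can only come from an
    unreachable pair.\<close>
  obtain u v where uv: "u \<in> V" "v \<in> V" "(u, v) \<notin> ?R"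
    using F V unfolding graph_connected_def by blast
  define S where "S = {w \<in> V. (u, w) \<in> ?R}"
  have step: "b \<in> S" if "a \<in> S" "b \<in> V" "{a, b} \<in> E - F" for a b
    using that unfolding S_def by (auto intro: rtrancl_into_rtrancl)
  have "e \<in> F" if e: "e \<in> edge_boundary E S" for e
  proof (rule ccontr)
    assume "e \<notin> F"
    moreover obtain a b where "a \<in> V" "b \<in> V" "e = {a, b}" "e \<in> E"
      using G e unfolding simple_graph_def edge_boundary_def by blast
    ultimately show False
      using e step[of a b] step[of b a] by (auto simp: edge_boundary_def insert_commute)
  qed
  moreover have "S \<subset> V" "S \<noteq> {}" using uv by (auto simp: S_def)
  ultimately show ?thesis using that by blast
qed

theorem theorem6p1:
  fixes V :: "'a set" and E :: "'a set set" and n k :: nat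
  assumes "simple_graph V E"
    and "card V = n"
    and "n \<ge> 2"
    and "graph_connected V E"
    and "edge_connectivity V E = k"
  shows "l1_fiedler V E \<le> (real n * real k) / (2 * (real n - 1))"
proof -
  have "2 \<le> card V" using assms by simp
  then obtain F where F: "F \<subseteq> E" "card F = k" "\<not> graph_connected V (E - F)"
    using edge_connectivity_attained(1)[OF assms(1)] assms(5) by blast
  have fin: "finite V" "V \<noteq> {}" using assms(2,3) by (auto intro: card_ge_0_finite)
  obtain S where S: "S \<subset> V" "S \<noteq> {}" "edge_boundary E S \<subseteq> F"
    using disconnecting_set_contains_edge_boundary[OF assms(1) fin(2) F(3)] .
  have "finite F" using F(1) simple_graph_finite_edges[OF assms(1)] finite_subset by blast
  \<comment> \<open>Inclusion in a minimum cut suffices, since only an upper bound on the boundary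
    is needed.\<close>
  then have b: "card (edge_boundary E S) \<le> k" using S(3) F(2) card_mono by blast
  have finS: "finite S" "finite (V - S)" using S fin finite_subset by auto
  define s t where "s = real (card S)" and "t = real (card (V - S))"
  have "card S > 0" "card (V - S) > 0" using S finS by (auto simp: card_gt_0_iff)
  then have st: "s \<ge> 1" "t \<ge> 1" by (auto simp: s_def t_def)
  have n: "real n = s + t"
    using card_Un_disjoint[OF finS] S assms(2)
    by (simp add: s_def t_def Un_absorb1 psubset_imp_subset)
  \<comment> \<open>Expanding the product gives \<open>s * t \<ge> s + t - 1\<close>, which is
    \<open>n - 1\<close>.\<close>
  have "0 \<le> (s - 1) * (t - 1)" using st by simp
  then have "real n - 1 \<le> s * t" by (simp add: n algebra_simps)
  have "l1_fiedler V E \<le> real n * real (card (edge_boundary E S)) / (2 * (s * t))"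
    using l1_fiedler_le_edge_boundary[OF assms(1) S(1,2)] assms(2) by (simp add: s_def t_def)
  \<comment> \<open>The numerator grows and the denominator shrinks; \<open>n \<ge> 2\<close> keeps
    the new denominator positive.\<close>
  also have "\<dots> \<le> real n * real k / (2 * (real n - 1))"
    using b \<open>real n - 1 \<le> s * t\<close> assms(3) by (intro frac_le mult_left_mono) auto
  finally show ?thesis .
qed

end
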